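(* Let $m \ge 2$ and $n\ge 1$, and let $\mathcal{A} = (a_{i_1\cdots i_m})$ be an $m$th order $n$-dimensional completely positive tensor. Let $(i_1,\dots,i_m),(j_1,\dots,j_m)\in\mathcal{I}$. If $(i_1,\dots,i_m)\preceq(j_1,\dots,j_m)$ and $a_{j_1\cdots j_m}\neq 0$, then $a_{i_1\cdots i_m}>0$.
   Context: A real $m$th order $n$-dimensional tensor is an array $\mathcal{A} = (a_{i_1\cdots i_m})$ of real numbers indexed by $1\le i_1,\dots,i_m\le n$. For $u\in\mathbb{R}^n$, $u^m$ denotes the rank-one tensor $(u_{i_1}\cdots u_{i_m})$. $\mathbb{R}^n_+$ is the set of nonnegative vectors in $\mathbb{R}^n$. $\mathcal{A}$ is called completely positive (CP) if there are finitely many vectors $u^{(1)},\dots,u^{(r)}\in\mathbb{R}^n_+$ with $\mathcal{A}=\sum_{k=1}^r (u^{(k)})^m$. $\mathcal{I}=\{(i_1,\dots,i_m): 1\le i_k\le n,\ k=1,\dots,m\}$. For $(i_1,\dots,i_m)\in\mathcal{I}$, $[(i_1,\dots,i_m)]$ is the set of distinct members of $\{i_1,\dots,i_m\}$. Write $(i_1,\dots,i_m)\preceq(j_1,\dots,j_m)$ if $[(i_1,\dots,i_m)]\subseteq[(j_1,\dots,j_m)]$. *)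

theory Defs
  imports "HOL-Analysis.Analysis"
begin

text \<open>
  Dimensions are types: vectors of \<open>\<real>\<^sup>n\<close> are \<^typ>\<open>real ^ 'n\<close> with \<open>n = CARD('n)\<close>, and an index tuple
  \<open>(i\<^sub>1, \<dots>, i\<^sub>m)\<close> is an element of \<^typ>\<open>'n ^ 'm\<close> with \<open>m = CARD('m)\<close>. The set of all
  index tuples is thus the whole type, and a tensor of order \<open>m\<close> and dimension \<open>n\<close> is a
  real vector over that finite type.
\<close>

type_synonym ('m, 'n) tensor = "(real, ('n, 'm) vec) vec"

definition rank_one :: "real ^ 'n \<Rightarrow> ('m::finite, 'n::finite) tensor" where
  "rank_one u = (\<chi> i. \<Prod>k\<in>UNIV. u $ (i $ k))"

definition nonneg_vectors :: "(real ^ 'n) set" where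
  "nonneg_vectors = {u. \<forall>i. 0 \<le> u $ i}"

definition completely_positive :: "('m::finite, 'n::finite) tensor \<Rightarrow> bool" where
  "completely_positive A \<longleftrightarrow>
     (\<exists>(r::nat) (u :: nat \<Rightarrow> real ^ 'n).
        (\<forall>k\<in>{1..r}. u k \<in> nonneg_vectors) \<and> A = (\<Sum>k=1..r. rank_one (u k)))"

definition index_support :: "'n ^ 'm \<Rightarrow> 'n set" where
  "index_support i = {i $ k | k. True}"

definition index_preceq :: "'n ^ 'm \<Rightarrow> 'n ^ 'm \<Rightarrow> bool"  (infix "\<preceq>" 50) where
  "i \<preceq> j \<longleftrightarrow> index_support i \<subseteq> index_support j"

end

theory Submission imports Defs begin

text \<open>
  For a nonnegative vector \<open>u\<close>, whether an entry of \<open>u\<^sup>m\<close> vanishes depends only on the index support: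
  the entry at \<open>j\<close> is positive exactly when \<open>u\<close> is positive on the support of \<open>j\<close>, and this
  property passes to every smaller support. An entry of a completely positive tensor is a sum of
  nonnegative entries of rank-one terms, so no cancellation can occur: if the entry at \<open>j\<close> is
  nonzero, some single term is positive at \<open>j\<close>, hence positive at \<open>i\<close>, and the remaining terms
  can only increase the entry at \<open>i\<close>.
\<close>

lemma rank_one_nonneg:
  fixes i :: "'n::finite ^ 'm::finite"
  assumes "u \<in> nonneg_vectors"
  shows "0 \<le> rank_one u $ i"
  using assms by (auto simp: rank_one_def nonneg_vectors_def intro: prod_nonneg)

lemma rank_one_pos_iff:
  fixes i :: "'n::finite ^ 'm::finite"
  assumes "u \<in> nonneg_vectors"
  shows "0 < rank_one u $ i \<longleftrightarrow> (\<forall>p\<in>index_support i. 0 < u $ p)"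
proof -
  have "0 < rank_one u $ i \<longleftrightarrow> rank_one u $ i \<noteq> 0"
    using rank_one_nonneg[OF assms, of i] by linarith
  also have "\<dots> \<longleftrightarrow> (\<forall>k. u $ (i $ k) \<noteq> 0)"
    by (simp add: rank_one_def)
  also have "\<dots> \<longleftrightarrow> (\<forall>p\<in>index_support i. 0 < u $ p)"
    using assms by (auto simp: nonneg_vectors_def index_support_def order_less_le)
  finally show ?thesis .
qed

theorem theorem3:
  fixes A :: "('m::finite, 'n::finite) tensor"
    and i j :: "'n ^ 'm"
  assumes "CARD('m) \<ge> 2"
    and "CARD('n) \<ge> 1"
    and "completely_positive A"
    and "i \<preceq> j"
    and "A $ j \<noteq> 0"
  shows "A $ i > 0"
proof -
  obtain r :: nat and u :: "nat \<Rightarrow> real ^ 'n"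
    where u: "\<And>k. k \<in> {1..r} \<Longrightarrow> u k \<in> nonneg_vectors"
      and A: "A = (\<Sum>k=1..r. rank_one (u k))"
    using assms(3) unfolding completely_positive_def by blast
  have entry: "A $ p = (\<Sum>k=1..r. rank_one (u k) $ p)" for p
    by (simp add: A)
  obtain k where k: "k \<in> {1..r}" and "rank_one (u k) $ j \<noteq> 0"
    using assms(5) unfolding entry by (meson sum.not_neutral_contains_not_neutral)
  with rank_one_nonneg[OF u[OF k], of j] have "0 < rank_one (u k) $ j"
    by linarith
  then have "0 < rank_one (u k) $ i"
    using assms(4) by (auto simp: rank_one_pos_iff[OF u[OF k]] index_preceq_def)
  then show ?thesis
    unfolding entry using k u by (intro sum_pos2[of _ k]) (auto intro: rank_one_nonneg)
qed

end
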